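(* Let $R_a,R_b,R_h$ be the expected numbers of valid blocks of Alice, Bob and Henry in a mining round, let $R_{vld}=R_a+R_b+R_h$ be the total number of valid blocks of all miners in a mining round, and let $R_{tot}=1$ be the total number of blocks (valid and orphaned) in the same round, where, due to orphaned blocks, $R_{tot}>R_{vld}$, and where $R_{tot}\le 4R_{vld}$ is assumed. In the difficulty adjustment model described in the context, the absolute revenue $\tilde R_i(K)$ of miner $i\in\{a,b,h\}$ over $K$ difficulty adjustment periods is $$\tilde R_i(K)=\frac{2016\cdot K\cdot R_i}{R_{vld}}\cdot\frac{1}{\sum_{k=1}^K E[T_k]}=\frac{K\,R_i}{R_{tot}+(K-1)R_{vld}}.$$ As $K$ increases, the absolute revenue is asymptotically close to the relative revenue $\hat R_i=\frac{R_i}{R_a+R_b+R_h}$, namely $$\tilde R_i(K)=\frac{K R_i}{R_{tot}+(K-1)R_{vld}}\approx\frac{K R_i}{R_{vld}+(K-1)R_{vld}}.$$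
   Context: Alice and Bob are selfish miners and Henry is an honest miner. A mining round is the process in which all miners start mining on the same public chain, go through block-hiding and block-releasing actions, and finally reach a consensus on the public chain again. Valid blocks are confirmed blocks in the longest chain. The unit of time is 10 minutes, and a difficulty adjustment (DAA) period is the expected number of time units of mining $2016$ valid blocks. Selfish mining starts with the first DAA period, in which one block is generated every time unit, so that a mining round occupies $R_{tot}$ time units and the expected length of the first period is $E[T_1]=\frac{2016}{R_{vld}}\cdot R_{tot}$ time units, which is longer than $2016$. After the first period the difficulty is decreased to match the current valid hash power, so that $T_k=2016$ for all $k\ge 2$, where $T_k$ is the expected number of time units of the $k$-th DAA period. The absolute revenue is the average number of (valid) blocks obtained in each time unit; $\tilde R_i(K)$ is the absolute revenue of miner $i$ over $K$ DAA periods. *)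

theory Defs
  imports "HOL-Probability.Probability" "HOL-Library.Landau_Symbols"
begin

datatype miner = Alice | Bob | Henry

text \<open>
  The random outcome of one mining round: the number of valid blocks of each miner and the number
  of orphaned blocks. The counts are real-valued because the normalisation of the expected total
  to one block per round (a hypothesis of the theorem) rescales them.
\<close>
locale mining_round = prob_space M for M :: "'w measure" +
  fixes valid :: "miner \<Rightarrow> 'w \<Rightarrow> real" and orphaned :: "'w \<Rightarrow> real"
  assumes integrable_valid: "\<And>i. integrable M (valid i)"
    and integrable_orphaned: "integrable M orphaned"
    and valid_nonneg: "\<And>i w. w \<in> space M \<Longrightarrow> 0 \<le> valid i w"
    and orphaned_nonneg: "\<And>w. w \<in> space M \<Longrightarrow> 0 \<le> orphaned w"

definition expected_valid :: "'w measure \<Rightarrow> (miner \<Rightarrow> 'w \<Rightarrow> real) \<Rightarrow> miner \<Rightarrow> real" where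
  "expected_valid M valid i = prob_space.expectation M (valid i)"

definition expected_total ::
    "'w measure \<Rightarrow> (miner \<Rightarrow> 'w \<Rightarrow> real) \<Rightarrow> ('w \<Rightarrow> real) \<Rightarrow> real" where
  "expected_total M valid orphaned =
     prob_space.expectation M (\<lambda>w. valid Alice w + valid Bob w + valid Henry w + orphaned w)"

definition total_valid :: "(miner \<Rightarrow> real) \<Rightarrow> real" where
  "total_valid R = R Alice + R Bob + R Henry"

definition relative_revenue :: "(miner \<Rightarrow> real) \<Rightarrow> miner \<Rightarrow> real" where
  "relative_revenue R i = R i / (R Alice + R Bob + R Henry)"

text \<open>
  Time is measured in units of 10 minutes. At difficulty \<open>d\<close> the miners together generate one
  block every \<open>d\<close> time units, so a round occupies \<open>R_tot * d\<close> time units. A period consists of as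
  many rounds as are expected to yield 2016 valid blocks.
\<close>
definition rounds_per_period :: "(miner \<Rightarrow> real) \<Rightarrow> real" where
  "rounds_per_period R = 2016 / total_valid R"

definition length_at :: "(miner \<Rightarrow> real) \<Rightarrow> real \<Rightarrow> real \<Rightarrow> real" where
  "length_at R R_tot d = rounds_per_period R * (R_tot * d)"

text \<open>
  The difficulty after \<open>n\<close> adjustments. An adjustment rescales the difficulty so that 2016 valid
  blocks, at the rate of the period just finished, would take 2016 time units; as in Bitcoin, a
  single adjustment changes the difficulty by a factor of at most 4 in either direction, which is
  why \<open>R_tot \<le> 4 * R_vld\<close> matters.
\<close>
primrec difficulty :: "(miner \<Rightarrow> real) \<Rightarrow> real \<Rightarrow> nat \<Rightarrow> real" where
  "difficulty R R_tot 0 = 1"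
| "difficulty R R_tot (Suc n) =
     difficulty R R_tot n *
       max (1 / 4) (min 4 (2016 / length_at R R_tot (difficulty R R_tot n)))"

text \<open>
  \<open>period_length R R_tot k\<close> is the expected length of the \<open>k\<close>-th period; periods are numbered
  from 1, so \<open>k - 1\<close> adjustments precede it. The value at 0 is irrelevant.
\<close>
definition period_length :: "(miner \<Rightarrow> real) \<Rightarrow> real \<Rightarrow> nat \<Rightarrow> real" where
  "period_length R R_tot k = length_at R R_tot (difficulty R R_tot (k - 1))"

text \<open>Valid blocks obtained per time unit over the first \<open>K\<close> periods.\<close>
definition absolute_revenue :: "(miner \<Rightarrow> real) \<Rightarrow> real \<Rightarrow> miner \<Rightarrow> nat \<Rightarrow> real" where
  "absolute_revenue R R_tot i K =
     (\<Sum>k=1..K. rounds_per_period R * R i) / (\<Sum>k=1..K. period_length R R_tot k)"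

end

(* After the first adjustment the difficulty is R_vld / R_tot, a fixed point of the adjustment rule;
   the bound R_tot <= 4 * R_vld keeps the clamp at a factor of 4 from interfering.
   So only the first period is longer than 2016, and its excess averages out over K periods. *)
theory Submission
  imports Defs "HOL-Real_Asymp.Real_Asymp"
begin

lemma length_at_eq: "length_at R T d = 2016 / total_valid R * (T * d)"
  by (simp add: length_at_def rounds_per_period_def)

lemma difficulty_Suc:
  assumes "0 < total_valid R" "total_valid R \<le> T" "T \<le> 4 * total_valid R"
  shows "difficulty R T (Suc n) = total_valid R / T"
proof (induction n)
  case 0
  \<comment> \<open>The initial difficulty is 1, so the first requested factor is V / T for V =
    \<open>total_valid R\<close>. It lies in [1/4, 1], so the clamp leaves it unchanged.\<close>
  have "2016 / length_at R T 1 = total_valid R / T"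
    using assms by (simp add: length_at_eq)
  moreover have "1 / 4 \<le> total_valid R / T" "total_valid R / T \<le> 4"
    using assms by (simp_all add: field_simps)
  ultimately show ?case by simp
next
  case (Suc n)
  have "length_at R T (total_valid R / T) = 2016"
    using assms by (simp add: length_at_eq)
  then show ?case
    \<comment> \<open>The instance unfolds only the outermost adjustment, so the induction
      hypothesis can rewrite the inner difficulty. The factor is then 2016 / 2016 = 1.\<close>
    unfolding difficulty.simps(2)[of R T "Suc n"] Suc.IH by simp
qed

lemma period_length_1: "period_length R T 1 = 2016 / total_valid R * T"
  by (simp add: period_length_def length_at_eq)

lemma period_length_ge_2:
  assumes "0 < total_valid R" "total_valid R \<le> T" "T \<le> 4 * total_valid R" "2 \<le> k"
  shows "period_length R T k = 2016"
proof -
  have "k - 1 = Suc (k - 2)"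
    using \<open>2 \<le> k\<close> by simp
  then have "difficulty R T (k - 1) = total_valid R / T"
    using difficulty_Suc[OF assms(1-3)] by metis
  then show ?thesis
    using assms(1,2) by (simp add: period_length_def length_at_eq)
qed

text \<open>The number of rounds per period, 2016 / V, is factored out so that it cancels in the
  revenue. A round takes T time units in the first period and V in each later one.\<close>

lemma sum_period_length:
  assumes "0 < total_valid R" "total_valid R \<le> T" "T \<le> 4 * total_valid R" "1 \<le> K"
  shows "(\<Sum>k=1..K. period_length R T k) =
    2016 / total_valid R * (T + (real K - 1) * total_valid R)"
proof -
  have "(\<Sum>k=1..K. period_length R T k) =
      period_length R T 1 + (\<Sum>k=2..K. period_length R T k)"
    using \<open>1 \<le> K\<close> by (simp add: sum.atLeast_Suc_atMost numeral_2_eq_2)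
  also have "(\<Sum>k=2..K. period_length R T k) = (\<Sum>k=2..K. 2016)"
    by (intro sum.cong refl period_length_ge_2 assms) simp
  also have "\<dots> = 2016 * (real K - 1)"
    using \<open>1 \<le> K\<close> by (simp add: of_nat_diff)
  finally show ?thesis
    using assms(1) unfolding period_length_1 by (simp add: field_simps)
qed

lemma absolute_revenue_eq_sum:
  "absolute_revenue R T i K =
    2016 * real K * R i / total_valid R * (1 / (\<Sum>k=1..K. period_length R T k))"
  by (simp add: absolute_revenue_def rounds_per_period_def)

lemma absolute_revenue_eq:
  assumes "0 < total_valid R" "total_valid R \<le> T" "T \<le> 4 * total_valid R" "1 \<le> K"
  shows "absolute_revenue R T i K = real K * R i / (T + (real K - 1) * total_valid R)"
  unfolding absolute_revenue_eq_sum sum_period_length[OF assms]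
  \<comment> \<open>Keeping 2016 undistributed over the sum lets the common factor 2016 / V
    cancel.\<close>
  using assms(1) by (simp del: distrib_left_numeral)

text \<open>Dividing numerator and denominator by K makes the constant term vanish. T is therefore
  left arbitrary, to cover both \<open>R_tot\<close> and \<open>R_vld\<close>.\<close>

lemma revenue_quotient_tendsto:
  fixes c T V :: real
  assumes "0 < V"
  shows "(\<lambda>K. real K * c / (T + (real K - 1) * V)) \<longlonglongrightarrow> c / V"
proof -
  have "(\<lambda>K. real K * c / (T + (real K - 1) * V)) \<longlonglongrightarrow> c * inverse V"
    using assms by real_asymp
  then show ?thesis
    by (simp only: divide_inverse)
qed

lemma revenue_quotient_asymp_equiv:
  fixes c S T V :: real
  assumes "0 < V"
  shows "(\<lambda>K. real K * c / (S + (real K - 1) * V)) \<sim>[at_top]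
    (\<lambda>K. real K * c / (T + (real K - 1) * V))"
\<comment> \<open>A common limit yields asymptotic equivalence only if it is nonzero. For c = 0 both
  sequences are identically 0.\<close>
proof (cases "c = 0")
  case False
  have "(\<lambda>K. real K * c / (U + (real K - 1) * V)) \<sim>[at_top] (\<lambda>_. c / V)" for U
    using False assms by (intro tendsto_imp_asymp_equiv_const revenue_quotient_tendsto) auto
  then show ?thesis
    by (blast intro: asymp_equiv_trans asymp_equiv_symI)
qed simp

theorem mainTheorem3:
  fixes M :: "'w measure"
    and valid :: "miner \<Rightarrow> 'w \<Rightarrow> real" and orphaned :: "'w \<Rightarrow> real"
    and R :: "miner \<Rightarrow> real" and R_vld R_tot :: real and i :: miner
  assumes "mining_round M valid orphaned"
    and "R = expected_valid M valid"
    and "R_vld = total_valid R"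
    and "R_tot = expected_total M valid orphaned"
    and "R_tot = 1"
    and "R_tot > R_vld"
    and "R_tot \<le> 4 * R_vld"
  shows "(period_length R R_tot 1 = 2016 / R_vld * R_tot) \<and>
    (period_length R R_tot 1 > 2016) \<and>
    (\<forall>k\<ge>2. period_length R R_tot k = 2016) \<and>
    (\<forall>K\<ge>1. absolute_revenue R R_tot i K =
           2016 * real K * R i / R_vld * (1 / (\<Sum>k=1..K. period_length R R_tot k))) \<and>
    (\<forall>K\<ge>1. absolute_revenue R R_tot i K = real K * R i / (R_tot + (real K - 1) * R_vld)) \<and>
    (\<forall>K\<ge>1. real K * R i / (R_vld + (real K - 1) * R_vld) = relative_revenue R i) \<and>
    (asymp_equiv (\<lambda>K. real K * R i / (R_tot + (real K - 1) * R_vld)) at_top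
           (\<lambda>K::nat. real K * R i / (R_vld + (real K - 1) * R_vld))) \<and>
    (absolute_revenue R R_tot i \<longlonglongrightarrow> relative_revenue R i)"
proof -
  \<comment> \<open>Positivity follows from 1 = \<open>R_tot\<close> <= 4 *
    \<open>R_vld\<close>.\<close>
  have V: "0 < total_valid R" "total_valid R \<le> R_tot" "R_tot \<le> 4 * total_valid R"
    using assms by auto
  have rel: "relative_revenue R i = R i / R_vld"
    using assms(3) by (simp add: relative_revenue_def total_valid_def)
  note eq = absolute_revenue_eq[OF V, of _ i, folded assms(3)]
  have long: "2016 < period_length R R_tot 1"
    using V(1) \<open>R_tot > R_vld\<close> unfolding assms(3) period_length_1 by (simp add: field_simps)
  have rel_eq: "real K * R i / (R_vld + (real K - 1) * R_vld) = relative_revenue R i"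
    if "1 \<le> K" for K
  proof -
    have "R_vld + (real K - 1) * R_vld = real K * R_vld"
      by (simp add: algebra_simps)
    then show ?thesis
      using that by (simp add: rel)
  qed
  \<comment> \<open>The closed form \<open>eq\<close> is available for K >= 1, which is enough to
    transfer the limit.\<close>
  have "\<forall>\<^sub>F K in sequentially.
      real K * R i / (R_tot + (real K - 1) * R_vld) = absolute_revenue R R_tot i K"
    using eventually_ge_at_top[of 1] by eventually_elim (simp add: eq)
  then have lim: "absolute_revenue R R_tot i \<longlonglongrightarrow> relative_revenue R i"
    unfolding rel
    using Lim_transform_eventually revenue_quotient_tendsto V(1) assms(3) by blast
  show ?thesis
    using period_length_1[of R R_tot] long period_length_ge_2[OF V] rel_eq lim
      absolute_revenue_eq_sum[of R R_tot i] eq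
      revenue_quotient_asymp_equiv[of R_vld "R i" R_tot R_vld] V(1)
    unfolding assms(3) by blast
qed

end
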